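(* Each of the following tasks can be performed by an algorithm using $O(n^2)$ operations, with an absolute implied constant: (a) given an integer $n\ge 1$, compute the list $P(n,1),P(n,2),\dots,P(n,n)$; (b) given integers $1\le m\le n$, compute the list $P(m,m),P(m+1,m),\dots,P(n,m)$.
   Context: $P(n,m)$ denotes the number of integer partitions of $n$ into exactly $m$ (positive) parts. Complexity is measured in the uniform unit-cost model: an algorithm is a single program (independent of the input) on a random access machine, and each addition, subtraction, multiplication or comparison of integers and each array access counts as one operation, regardless of the size of the integers. *)

theory Defs
  imports Complex_Main "HOL-Library.Multiset"
begin

definition num_partitions :: "nat \<Rightarrow> nat \<Rightarrow> nat" where
  "num_partitions n m = card {M :: nat multiset. sum_mset M = n \<and> size M = m \<and> 0 \<notin># M}"

text \<open>The cardinality above is that of a finite set, so \<open>card\<close> has its intended meaning.\<close>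

lemma finite_partitions:
  "finite {M :: nat multiset. sum_mset M = n \<and> size M = m \<and> 0 \<notin># M}"
proof (rule finite_subset)
  show "{M :: nat multiset. sum_mset M = n \<and> size M = m \<and> 0 \<notin># M}
    \<subseteq> mset ` {xs. set xs \<subseteq> {..n} \<and> length xs = m}"
  proof
    fix M :: "nat multiset"
    assume M: "M \<in> {M. sum_mset M = n \<and> size M = m \<and> 0 \<notin># M}"
    obtain xs where xs: "M = mset xs" by (metis ex_mset)
    have "set xs \<subseteq> {..n}"
      using M xs member_le_sum_list[of _ xs] by (auto simp: sum_mset_sum_list)
    with M xs show "M \<in> mset ` {xs. set xs \<subseteq> {..n} \<and> length xs = m}" by auto
  qed
  show "finite (mset ` {xs. set xs \<subseteq> {..n} \<and> length xs = m})"
    by (intro finite_imageI finite_lists_length_eq) simp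
qed

text \<open>
  A random access machine in the style of Cook and Reckhow, with multiplication. Registers
  \<open>X 0, X 1, \<dots>\<close> hold integers of arbitrary size and are initially zero; there is an input
  list read from the front and an output list written at the end. Array access is indirect
  addressing. Every executed instruction costs one, including jumps, constants and
  input/output.
  \<^item> \<open>Const i k\<close>: \<open>X i := k\<close>
  \<^item> \<open>Add i j k\<close>, \<open>Sub i j k\<close>, \<open>Mult i j k\<close>: \<open>X i := X j \<circ> X k\<close>
  \<^item> \<open>Load i j\<close>: \<open>X i := X (X j)\<close>
  \<^item> \<open>Store i j\<close>: \<open>X (X i) := X j\<close>
  \<^item> \<open>Jump_less i j l\<close>: continue at instruction \<open>l\<close> if \<open>X i < X j\<close>
\<close>

datatype instr =
    Const nat int
  | Add nat nat nat
  | Sub nat nat nat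
  | Mult nat nat nat
  | Load nat nat
  | Store nat nat
  | Jump nat
  | Jump_less nat nat nat
  | Read nat
  | Print nat
  | Halt

record config =
  pc :: nat
  mem :: "nat \<Rightarrow> int"
  inp :: "int list"
  out :: "int list"

definition set_reg :: "nat \<Rightarrow> int \<Rightarrow> config \<Rightarrow> config" where
  "set_reg i v c = c\<lparr>pc := Suc (pc c), mem := (mem c)(i := v)\<rparr>"

text \<open>
  The result \<open>None\<close> means that there is no next step: the machine has halted, or it is stuck
  on a negative address, an exhausted input, or a program counter outside the program.
\<close>

fun exec :: "instr \<Rightarrow> config \<Rightarrow> config option" where
  "exec (Const i k) c = Some (set_reg i k c)"
| "exec (Add i j k) c = Some (set_reg i (mem c j + mem c k) c)"
| "exec (Sub i j k) c = Some (set_reg i (mem c j - mem c k) c)"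
| "exec (Mult i j k) c = Some (set_reg i (mem c j * mem c k) c)"
| "exec (Load i j) c =
     (if mem c j < 0 then None else Some (set_reg i (mem c (nat (mem c j))) c))"
| "exec (Store i j) c =
     (if mem c i < 0 then None else Some (set_reg (nat (mem c i)) (mem c j) c))"
| "exec (Jump l) c = Some (c\<lparr>pc := l\<rparr>)"
| "exec (Jump_less i j l) c =
     Some (c\<lparr>pc := (if mem c i < mem c j then l else Suc (pc c))\<rparr>)"
| "exec (Read i) c =
     (case inp c of [] \<Rightarrow> None | x # xs \<Rightarrow> Some (set_reg i x (c\<lparr>inp := xs\<rparr>)))"
| "exec (Print i) c = Some (c\<lparr>pc := Suc (pc c), out := out c @ [mem c i]\<rparr>)"
| "exec Halt c = None"

definition step :: "instr list \<Rightarrow> config \<Rightarrow> config option" where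
  "step prog c = (if pc c < length prog then exec (prog ! pc c) c else None)"

primrec run :: "instr list \<Rightarrow> nat \<Rightarrow> config \<Rightarrow> config option" where
  "run prog 0 c = Some c"
| "run prog (Suc t) c = Option.bind (step prog c) (run prog t)"

definition init :: "int list \<Rightarrow> config" where
  "init xs = \<lparr>pc = 0, mem = (\<lambda>_. 0), inp = xs, out = []\<rparr>"

definition halted :: "instr list \<Rightarrow> config \<Rightarrow> bool" where
  "halted prog c \<longleftrightarrow> pc c < length prog \<and> prog ! pc c = Halt"

definition computes_within :: "instr list \<Rightarrow> int list \<Rightarrow> int list \<Rightarrow> nat \<Rightarrow> bool" where
  "computes_within prog xs ys T \<longleftrightarrow>
     (\<exists>t\<le>T. \<exists>c. run prog t (init xs) = Some c \<and> halted prog c \<and> out c = ys)"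

end

(* Removing one part 1, or else subtracting 1 from every part, gives
   P(i+j, j) = P(i+j-1, j-1) + P(i, j). Hence q_j(i) = P(i+j, j) satisfies
   q_j(i) = q_{j-1}(i) + q_j(i-j), and a single array holding q_j(0), ..., q_j(n) can be updated
   in place from j-1 to j by running i upwards from j to n. This stage costs O(n) operations, and
   only O(n) stages are needed. For (a), P(n, j) = q_j(n-j) is printed after stage j; for (b),
   q_m(0), ..., q_m(n-m) is printed after stage m. *)

theory Submission imports Defs begin

section \<open>The recurrence\<close>

lemma sum_mset_image_Suc: "sum_mset (image_mset Suc M) = sum_mset M + size M"
  by (induction M) auto

lemma num_partitions_0_right: "num_partitions n 0 = (if n = 0 then 1 else 0)"
proof -
  have "{M :: nat multiset. sum_mset M = n \<and> size M = 0 \<and> 0 \<notin># M} = (if n = 0 then {{#}} else {})"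
    by auto
  then show ?thesis by (simp add: num_partitions_def)
qed

lemma num_partitions_eq_0:
  assumes "n < m"
  shows "num_partitions n m = 0"
proof -
  have "size M \<le> sum_mset M" if "0 \<notin># M" for M :: "nat multiset"
    using that by (induction M) auto
  then have "{M :: nat multiset. sum_mset M = n \<and> size M = m \<and> 0 \<notin># M} = {}"
    using assms by fastforce
  then show ?thesis unfolding num_partitions_def by (metis card.empty)
qed

lemma num_partitions_rec:
  "num_partitions (n + Suc m) (Suc m) = num_partitions (n + m) m + num_partitions n (Suc m)"
proof -
  define S where "S n m = {M :: nat multiset. sum_mset M = n \<and> size M = m \<and> 0 \<notin># M}" for n m
  have fin: "finite (S n m)" for n m
    unfolding S_def by (rule finite_partitions)
  have split: "S (n + Suc m) (Suc m) = add_mset 1 ` S (n + m) m \<union> image_mset Suc ` S n (Suc m)"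
    (is "?L = ?A \<union> ?B")
  proof (intro equalityI subsetI)
    fix M assume M: "M \<in> ?L"
    show "M \<in> ?A \<union> ?B"
    proof (cases "1 \<in># M")
      case True
      then obtain N where "M = add_mset 1 N" by (metis insert_DiffM)
      with M show ?thesis by (auto simp: S_def)
    next
      case False
      define N where "N = image_mset (\<lambda>x. x - 1) M"
      \<comment> \<open>Natural subtraction truncates: \<open>x - 1\<close> is undone by
        \<open>Suc\<close> only for positive \<open>x\<close>, and it stays positive only for
        \<open>x\<close> at least 2. Both are needed to recover \<open>M\<close> from
        \<open>N\<close> and to keep 0 out of \<open>N\<close>.\<close>
      have ge2: "x \<ge> 2" if "x \<in># M" for x
        using that M False by (cases x; cases "x = 1") (auto simp: S_def)
      have MN: "M = image_mset Suc N"
        unfolding N_def image_mset.compositionality comp_def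
        using ge2 by (subst image_mset_cong[of M _ "\<lambda>x. x"]) fastforce+
      have "0 \<notin># N" using ge2 by (fastforce simp: N_def)
      then have "N \<in> S n (Suc m)"
        using M MN by (auto simp: S_def sum_mset_image_Suc)
      with MN show ?thesis by blast
    qed
  next
    fix M assume "M \<in> ?A \<union> ?B"
    then show "M \<in> ?L" by (auto simp: S_def sum_mset_image_Suc)
  qed
  have "?A \<inter> ?B = {}"
  proof -
    have "1 \<in># M" if "M \<in> ?A" for M using that by auto
    moreover have "1 \<notin># M" if "M \<in> ?B" for M using that by (auto simp: S_def)
    ultimately show ?thesis by blast
  qed
  then have "card (S (n + Suc m) (Suc m)) = card ?A + card ?B"
    unfolding split by (intro card_Un_disjoint) (auto simp: fin)
  also have "card ?A = card (S (n + m) m)"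
    by (rule card_image) (auto simp: inj_on_def)
  also have "card ?B = card (S n (Suc m))"
    by (rule card_image) (rule inj_on_subset[OF multiset.inj_map[OF inj_Suc] subset_UNIV])
  finally show ?thesis by (simp add: num_partitions_def S_def)
qed

text \<open>The index \<open>i\<close> is the excess over the least possible sum \<open>j\<close>,
  so \<open>q j i\<close> also counts the partitions of \<open>i\<close> into at most
  \<open>j\<close> parts. With this shift an entry and its predecessor from the previous stage share
  one index, hence one array cell.\<close>

definition q :: "nat \<Rightarrow> nat \<Rightarrow> int" where
  "q j i = int (num_partitions (i + j) j)"

lemma q_0: "q 0 i = (if i = 0 then 1 else 0)"
  by (simp add: q_def num_partitions_0_right)

text \<open>The other summand of the recurrence is \<open>num_partitions i (Suc j)\<close>, which
  vanishes because \<open>i < Suc j\<close>.\<close>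

lemma q_Suc_less: "i \<le> j \<Longrightarrow> q (Suc j) i = q j i"
  using num_partitions_rec[of i j] by (simp add: q_def num_partitions_eq_0)

text \<open>Here \<open>num_partitions i (Suc j)\<close> is an entry of the new stage at the smaller
  index \<open>i - Suc j\<close>. An ascending pass has already computed it, which is what makes the
  in-place update correct.\<close>

lemma q_Suc_ge: "Suc j \<le> i \<Longrightarrow> q (Suc j) i = q j i + q (Suc j) (i - Suc j)"
  using num_partitions_rec[of i j] by (simp add: q_def)

section \<open>Bounded reachability\<close>

text \<open>A total-correctness assertion with a step budget. Since \<open>T\<close> is only an
  upper bound, budgets can be rounded up to forms that do not depend on the stage.\<close>

definition reaches :: "instr list \<Rightarrow> nat \<Rightarrow> config \<Rightarrow> (config \<Rightarrow> bool) \<Rightarrow> bool" where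
  "reaches prog T c Q \<longleftrightarrow> (\<exists>t\<le>T. \<exists>c'. run prog t c = Some c' \<and> Q c')"

lemma run_add: "run prog (s + t) c = Option.bind (run prog s c) (run prog t)"
  by (induction s arbitrary: c) (auto simp: bind_assoc split: bind_splits)

text \<open>Lets the simplifier execute a fixed number of instructions symbolically.\<close>

lemma run_numeral:
  "run prog (numeral k) c = Option.bind (step prog c) (run prog (pred_numeral k))"
  by (simp add: numeral_eq_Suc)

lemma reaches_final: "run prog s c = Some c' \<Longrightarrow> Q c' \<Longrightarrow> s \<le> T \<Longrightarrow> reaches prog T c Q"
  unfolding reaches_def by blast

lemma reaches_trans:
  assumes "reaches prog S c Q" and "\<And>c'. Q c' \<Longrightarrow> reaches prog T c' R" and "S + T \<le> U"
  shows "reaches prog U c R"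
proof -
  obtain s c' where s: "s \<le> S" "run prog s c = Some c'" "Q c'"
    using assms(1) by (auto simp: reaches_def)
  obtain t c'' where t: "t \<le> T" "run prog t c' = Some c''" "R c''"
    using assms(2)[OF s(3)] by (auto simp: reaches_def)
  have "run prog (s + t) c = Some c''" using s t by (simp add: run_add)
  with s t assms(3) show ?thesis unfolding reaches_def by (intro exI[of _ "s + t"]) auto
qed

text \<open>Prefixes a symbolically executed block of exact length \<open>s\<close> to a bounded
  continuation; all slack is left to one final inequality.\<close>

lemma reaches_run:
  assumes "run prog s c = Some c'" and "reaches prog T c' R" and "s + T \<le> U"
  shows "reaches prog U c R"
  by (rule reaches_trans[of prog s c "\<lambda>x. x = c'"]) (use assms in \<open>auto simp: reaches_def\<close>)

lemma computes_within_iff_reaches: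
  "computes_within prog xs ys T \<longleftrightarrow> reaches prog T (init xs) (\<lambda>c. halted prog c \<and> out c = ys)"
  by (simp add: computes_within_def reaches_def)

section \<open>One stage of the array update\<close>

text \<open>Register 0 holds the number of stages, register 1 the constant 1, register 2 the stage \<open>j\<close>,
  register 6 the base address 8 of the array and register 7 its last address \<open>n + 8\<close>; registers 3
  to 5 are scratch. The code is placed at address \<open>a\<close>.\<close>

definition stage :: "nat \<Rightarrow> instr list" where
  "stage a = [Add 3 2 6, Jump_less 7 3 (a + 9), Sub 4 3 2, Load 4 4, Load 5 3, Add 5 5 4,
     Store 3 5, Add 3 3 1, Jump (Suc a)]"

text \<open>Jump targets are absolute, so the stage code depends on its address. Abstracting from
  the surrounding program allows one correctness proof to serve both programs.\<close>

definition has_stage :: "instr list \<Rightarrow> nat \<Rightarrow> bool" where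
  "has_stage prog a \<longleftrightarrow> take 9 (drop a prog) = stage a"

lemma has_stageD:
  assumes "has_stage prog a" and "k < 9"
  shows "a + k < length prog" and "prog ! (a + k) = stage a ! k"
proof -
  have eq: "take 9 (drop a prog) = stage a" using assms(1) by (simp add: has_stage_def)
  then have "length (take 9 (drop a prog)) = 9" by (simp add: stage_def)
  then show "a + k < length prog" using assms(2) by auto
  then show "prog ! (a + k) = stage a ! k"
    using assms(2) by (simp flip: eq)
qed

text \<open>The program counters are towers of \<open>Suc\<close> because \<open>set_reg\<close>
  advances by \<open>Suc\<close>; in this form the equations rewrite each state met during symbolic
  execution.\<close>

lemma step_stage:
  assumes "has_stage prog a"
  shows "pc c = a \<Longrightarrow> step prog c = exec (Add 3 2 6) c"
    and "pc c = Suc a \<Longrightarrow> step prog c = exec (Jump_less 7 3 (a + 9)) c"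
    and "pc c = Suc (Suc a) \<Longrightarrow> step prog c = exec (Sub 4 3 2) c"
    and "pc c = Suc (Suc (Suc a)) \<Longrightarrow> step prog c = exec (Load 4 4) c"
    and "pc c = Suc (Suc (Suc (Suc a))) \<Longrightarrow> step prog c = exec (Load 5 3) c"
    and "pc c = Suc (Suc (Suc (Suc (Suc a)))) \<Longrightarrow> step prog c = exec (Add 5 5 4) c"
    and "pc c = Suc (Suc (Suc (Suc (Suc (Suc a))))) \<Longrightarrow> step prog c = exec (Store 3 5) c"
    and "pc c = Suc (Suc (Suc (Suc (Suc (Suc (Suc a)))))) \<Longrightarrow> step prog c = exec (Add 3 3 1) c"
    and "pc c = Suc (Suc (Suc (Suc (Suc (Suc (Suc (Suc a))))))) \<Longrightarrow> step prog c = exec (Jump (Suc a)) c"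
proof -
  note nth = has_stageD(2)[OF assms, unfolded stage_def] and len = has_stageD(1)[OF assms]
  show "pc c = a \<Longrightarrow> step prog c = exec (Add 3 2 6) c"
    using nth[of 0] len[of 0] by (simp add: step_def numeral_eq_Suc)
  show "pc c = Suc a \<Longrightarrow> step prog c = exec (Jump_less 7 3 (a + 9)) c"
    using nth[of 1] len[of 1] by (simp add: step_def numeral_eq_Suc)
  show "pc c = Suc (Suc a) \<Longrightarrow> step prog c = exec (Sub 4 3 2) c"
    using nth[of 2] len[of 2] by (simp add: step_def numeral_eq_Suc)
  show "pc c = Suc (Suc (Suc a)) \<Longrightarrow> step prog c = exec (Load 4 4) c"
    using nth[of 3] len[of 3] by (simp add: step_def numeral_eq_Suc)
  show "pc c = Suc (Suc (Suc (Suc a))) \<Longrightarrow> step prog c = exec (Load 5 3) c"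
    using nth[of 4] len[of 4] by (simp add: step_def numeral_eq_Suc)
  show "pc c = Suc (Suc (Suc (Suc (Suc a)))) \<Longrightarrow> step prog c = exec (Add 5 5 4) c"
    using nth[of 5] len[of 5] by (simp add: step_def numeral_eq_Suc)
  show "pc c = Suc (Suc (Suc (Suc (Suc (Suc a))))) \<Longrightarrow> step prog c = exec (Store 3 5) c"
    using nth[of 6] len[of 6] by (simp add: step_def numeral_eq_Suc)
  show "pc c = Suc (Suc (Suc (Suc (Suc (Suc (Suc a)))))) \<Longrightarrow> step prog c = exec (Add 3 3 1) c"
    using nth[of 7] len[of 7] by (simp add: step_def numeral_eq_Suc)
  show "pc c = Suc (Suc (Suc (Suc (Suc (Suc (Suc (Suc a))))))) \<Longrightarrow> step prog c = exec (Jump (Suc a)) c"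
    using nth[of 8] len[of 8] by (simp add: step_def numeral_eq_Suc)
qed

definition regs :: "nat \<Rightarrow> nat \<Rightarrow> nat \<Rightarrow> config \<Rightarrow> bool" where
  "regs m n j c \<longleftrightarrow> mem c 0 = int m \<and> mem c 1 = 1 \<and> mem c 2 = int j \<and> mem c 6 = 8 \<and>
     mem c 7 = int n + 8"

text \<open>In \<open>arr n j i c\<close> the entries below \<open>i\<close> have already been updated from stage \<open>j\<close> to \<open>Suc j\<close>.\<close>

definition arr :: "nat \<Rightarrow> nat \<Rightarrow> nat \<Rightarrow> config \<Rightarrow> bool" where
  "arr n j i c \<longleftrightarrow> (\<forall>k\<le>n. mem c (k + 8) = q (if k < i then Suc j else j) k)"

lemma regsD:
  assumes "regs m n j c"
  shows "mem c 0 = int m" "mem c (Suc 0) = 1" "mem c 2 = int j" "mem c 6 = 8" "mem c 7 = int n + 8"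
  using assms by (simp_all add: regs_def)

lemma arrD: "arr n j i c \<Longrightarrow> k \<le> n \<Longrightarrow> mem c (k + 8) = q (if k < i then Suc j else j) k"
  by (simp add: arr_def)

text \<open>Entries \<open>0\<close> to \<open>j\<close> agree in both stages by
  \<open>q_Suc_less\<close>, so the pass may begin at index \<open>Suc j\<close>.\<close>

lemma arr_start: "arr n j 0 c \<Longrightarrow> arr n j (Suc j) c"
  by (simp add: arr_def q_Suc_less)

text \<open>Induction on the number \<open>d\<close> of entries still to be updated; the second
  disjunct allows a start beyond the array. A pass through the body costs 8 instructions, the
  failing exit test 1. Once \<open>i\<close> exceeds \<open>n\<close>, the whole array is at stage
  \<open>Suc j\<close>.\<close>

lemma stage_loop:
  assumes "has_stage prog a" and "Suc n = i + d \<or> n < i \<and> d = 0" and "pc c = Suc a"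
    and "regs m n (Suc j) c" and "mem c 3 = int i + 8" and "Suc j \<le> i" and "arr n j i c"
  shows "reaches prog (8 * d + 1) c
    (\<lambda>c'. pc c' = a + 9 \<and> out c' = out c \<and> regs m n (Suc j) c' \<and> arr n (Suc j) 0 c')"
  using assms(2-)
proof (induction d arbitrary: i c)
  case 0
  have i: "n < i" using 0(1) by arith
  have run: "run prog 1 c = Some (c\<lparr>pc := a + 9\<rparr>)"
    using i by (simp add: step_stage[OF assms(1)] 0(2,4) regsD[OF 0(3)])
  have "arr n (Suc j) 0 c"
    using 0(6) i by (simp add: arr_def)
  then show ?case
    using 0(3) by (intro reaches_final[OF run]) (simp_all add: regs_def arr_def)
next
  case (Suc d)
  have n: "Suc n = Suc i + d" using Suc.prems(1) by simp
  obtain s where s: "i = s + Suc j" using Suc.prems(5) by (metis le_add_diff_inverse2)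
  \<comment> \<open>Since \<open>s = i - Suc j\<close> lies below \<open>i\<close>, its cell already
    holds the new stage, while cell \<open>i + 8\<close> still holds the old one.\<close>
  have old: "mem c (s + 8) = q (Suc j) s" "mem c (i + 8) = q j i"
    using arrD[OF Suc.prems(6), of s] arrD[OF Suc.prems(6), of i] n s by simp_all
  have new: "q (Suc j) i = q j i + q (Suc j) s"
    using q_Suc_ge[of j i] s by simp
  have addr: "int i + 8 - int (Suc j) = int s + 8" "nat (int s + 8) = s + 8" "nat (int i + 8) = i + 8"
    using s by simp_all
  define c' where "c' = c\<lparr>pc := Suc a, mem := (mem c)
     (4 := q (Suc j) s, 5 := q (Suc j) i, i + 8 := q (Suc j) i, 3 := int (Suc i) + 8)\<rparr>"
  \<comment> \<open>The updates in \<open>c'\<close> follow the order of the instructions. Keeping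
    \<open>int (Suc j)\<close> folded lets the address equations in \<open>addr\<close>
    apply.\<close>
  have run: "run prog 8 c = Some c'"
    using n by (simp add: run_numeral step_stage[OF assms(1)] set_reg_def Suc.prems(2,4)
        regsD[OF Suc.prems(3)] addr old c'_def new del: of_nat_Suc) simp
  have "regs m n (Suc j) c'" using Suc.prems(3) by (simp add: regs_def c'_def)
  moreover have "arr n j (Suc i) c'"
    using Suc.prems(6) by (simp add: arr_def c'_def less_Suc_eq)
  moreover have "pc c' = Suc a" "mem c' 3 = int (Suc i) + 8" and out: "out c' = out c"
    by (simp_all add: c'_def)
  moreover have "Suc j \<le> Suc i" using s by simp
  ultimately have "reaches prog (8 * d + 1) c'
      (\<lambda>c'. pc c' = a + 9 \<and> out c' = out c \<and> regs m n (Suc j) c' \<and> arr n (Suc j) 0 c')"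
    using Suc.IH[of "Suc i" c'] n by metis
  then show ?case by (rule reaches_run[OF run]) simp
qed

text \<open>One instruction sets the start address, then the loop runs \<open>n - j\<close> times.
  Bounding \<open>n - j\<close> by \<open>n\<close> gives a cost independent of \<open>j\<close>, so
  the total over all stages is a product.\<close>

lemma stage_correct:
  assumes "has_stage prog a" and "pc c = a" and "regs m n (Suc j) c" and "arr n j 0 c"
  shows "reaches prog (8 * n + 2) c
    (\<lambda>c'. pc c' = a + 9 \<and> out c' = out c \<and> regs m n (Suc j) c' \<and> arr n (Suc j) 0 c')"
proof -
  define c' where "c' = c\<lparr>pc := Suc a, mem := (mem c)(3 := int (Suc j) + 8)\<rparr>"
  have run: "run prog 1 c = Some c'"
    by (simp add: step_stage[OF assms(1)] assms(2) set_reg_def c'_def regsD[OF assms(3)])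
  have "regs m n (Suc j) c'" using assms(3) by (simp add: regs_def c'_def)
  moreover have "arr n j (Suc j) c'" using arr_start[OF assms(4)] by (simp add: arr_def c'_def)
  \<comment> \<open>For \<open>j > n\<close> the truncated difference \<open>n - j\<close> is 0 and
    the second alternative holds.\<close>
  moreover have "Suc n = Suc j + (n - j) \<or> n < Suc j \<and> n - j = 0" by arith
  moreover have "pc c' = Suc a" "mem c' 3 = int (Suc j) + 8" and out: "out c' = out c"
    by (simp_all add: c'_def)
  ultimately have "reaches prog (8 * (n - j) + 1) c'
      (\<lambda>c'. pc c' = a + 9 \<and> out c' = out c \<and> regs m n (Suc j) c' \<and> arr n (Suc j) 0 c')"
    using stage_loop[OF assms(1), of n "Suc j" "n - j" c' m j] by simp
  then show ?thesis by (rule reaches_run[OF run]) simp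
qed

section \<open>The two programs\<close>

text \<open>Instructions 0 to 5 initialise, 6 tests for the end, 7 to 15 are the stage, 16 to 20
  print one entry and loop, 21 halts. The array starts at address 8, just after registers 0 to
  7.\<close>

definition row_prog :: "instr list" where
  "row_prog = [Read 0, Const 1 1, Const 6 8, Add 7 0 6, Store 6 1, Const 2 1, Jump_less 0 2 21] @
     stage 7 @ [Sub 4 7 2, Load 4 4, Print 4, Add 2 2 1, Jump 6, Halt]"

lemma has_stage_row_prog: "has_stage row_prog 7"
  by (simp add: has_stage_def row_prog_def stage_def)

text \<open>Induction on the number \<open>d\<close> of stages left. At the loop head register 2
  holds the coming stage \<open>Suc j\<close>, while the array is still at stage \<open>j\<close>. A
  round costs 1 for the test, \<open>8 * n + 2\<close> for the stage and 5 for printing.\<close>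

lemma row_prog_loop:
  assumes "n = j + d" and "pc c = 6" and "regs n n (Suc j) c" and "arr n j 0 c"
    and "out c = map (\<lambda>m. int (num_partitions n m)) [1..<Suc j]"
  shows "reaches row_prog (d * (8 * n + 8) + 1) c
    (\<lambda>c'. halted row_prog c' \<and> out c' = map (\<lambda>m. int (num_partitions n m)) [1..<Suc n])"
  using assms
proof (induction d arbitrary: j c)
  case 0
  have run: "run row_prog 1 c = Some (c\<lparr>pc := 21\<rparr>)"
    using 0(1) by (simp add: step_def row_prog_def stage_def 0(2) regsD[OF 0(3)])
  have "halted row_prog (c\<lparr>pc := 21\<rparr>)"
    by (simp add: halted_def row_prog_def stage_def)
  then show ?case
    using 0(1,5) by (intro reaches_final[OF run]) simp_all
next
  case (Suc d)
  have n: "n = Suc j + d" using Suc.prems(1) by simp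
  have run1: "run row_prog 1 c = Some (c\<lparr>pc := 7\<rparr>)"
    using n by (simp add: step_def row_prog_def stage_def Suc.prems(2) regsD[OF Suc.prems(3)])
  have st: "reaches row_prog (8 * n + 2) (c\<lparr>pc := 7\<rparr>)
      (\<lambda>c'. pc c' = 16 \<and> out c' = out c \<and> regs n n (Suc j) c' \<and> arr n (Suc j) 0 c')"
    using stage_correct[OF has_stage_row_prog, of "c\<lparr>pc := 7\<rparr>" n n j] Suc.prems(3,4)
    by (simp add: regs_def arr_def)
  have "reaches row_prog (d * (8 * n + 8) + 6) c'
    (\<lambda>c'. halted row_prog c' \<and> out c' = map (\<lambda>m. int (num_partitions n m)) [1..<Suc n])"
    if c': "pc c' = 16 \<and> out c' = out c \<and> regs n n (Suc j) c' \<and> arr n (Suc j) 0 c'" for c'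
  proof -
    define v where "v = int (num_partitions n (Suc j))"
    have pc: "pc c' = 16" and out: "out c' = out c" and regs: "regs n n (Suc j) c'"
      and arr: "arr n (Suc j) 0 c'"
      using c' by simp_all
    \<comment> \<open>Here \<open>d = n - Suc j\<close>, so subtracting the stage number from the
      last address yields the cell of \<open>q (Suc j) (n - Suc j)\<close>, which is
      \<open>P(n, Suc j)\<close>.\<close>
    have addr: "int n + 8 - int (Suc j) = int d + 8" "nat (int d + 8) = d + 8"
      using n by simp_all
    have val: "mem c' (d + 8) = v"
      using arrD[OF arr, of d] n by (simp add: q_def v_def add.commute)
    define c2 where "c2 = c'\<lparr>pc := 6, out := out c @ [v],
      mem := (mem c')(4 := v, 2 := int (Suc j) + 1)\<rparr>"
    have run: "run row_prog 5 c' = Some c2"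
      by (simp add: run_numeral step_def row_prog_def stage_def set_reg_def pc out regsD[OF regs]
        addr val c2_def del: of_nat_Suc)
    have "regs n n (Suc (Suc j)) c2" using regs by (simp add: regs_def c2_def)
    moreover have "arr n (Suc j) 0 c2" using arr by (simp add: arr_def c2_def)
    moreover have "out c2 = map (\<lambda>m. int (num_partitions n m)) [1..<Suc (Suc j)]"
      by (simp add: c2_def v_def Suc.prems(5))
    ultimately have "reaches row_prog (d * (8 * n + 8) + 1) c2
      (\<lambda>c'. halted row_prog c' \<and> out c' = map (\<lambda>m. int (num_partitions n m)) [1..<Suc n])"
      by (intro Suc.IH[OF n]) (simp_all add: c2_def)
    then show ?thesis by (rule reaches_run[OF run]) simp
  qed
  from reaches_trans[OF st this order_refl]
  show ?case
  proof (rule reaches_run[OF run1])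
    show "1 + (8 * n + 2 + (d * (8 * n + 8) + 6)) \<le> Suc d * (8 * n + 8) + 1" by simp
  qed
qed

lemma row_prog_correct:
  assumes "1 \<le> n"
  shows "computes_within row_prog [int n]
    (map (\<lambda>m. int (num_partitions n m)) [1..<Suc n]) (23 * n\<^sup>2)"
proof -
  define c where "c = \<lparr>pc = 6, mem = (\<lambda>_. 0)(0 := int n, 1 := 1, 6 := 8, 7 := int n + 8, 8 := 1, 2 := 1),
    inp = [], out = []\<rparr>"
  have run: "run row_prog 6 (init [int n]) = Some c"
    by (simp add: run_numeral step_def row_prog_def stage_def set_reg_def init_def c_def fun_upd_twist)
  have "reaches row_prog (n * (8 * n + 8) + 1) c
    (\<lambda>c'. halted row_prog c' \<and> out c' = map (\<lambda>m. int (num_partitions n m)) [1..<Suc n])"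
    \<comment> \<open>The initial array must be \<open>q 0\<close>, that is 1, 0, 0, and so on:
      memory starts at zero and \<open>Store 6 1\<close> has put 1 into cell 8.\<close>
    by (rule row_prog_loop[where j = 0]) (simp_all add: c_def regs_def arr_def q_0)
  \<comment> \<open>The left side is \<open>8 * n * n + 8 * n + 7\<close>, and 23 = 8 + 8 +
    7.\<close>
  moreover have "6 + (n * (8 * n + 8) + 1) \<le> 23 * n\<^sup>2"
  proof -
    have "n \<le> n\<^sup>2" "1 \<le> n\<^sup>2" using assms by (simp_all add: power2_eq_square)
    moreover have "n * n = n\<^sup>2" by (simp add: power2_eq_square)
    ultimately show ?thesis by (simp add: algebra_simps)
  qed
  ultimately show ?thesis
    unfolding computes_within_iff_reaches by (rule reaches_run[OF run])
qed

section \<open>Task (b): the column of all \<open>P(k,m)\<close> for fixed \<open>m\<close>\<close>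

text \<open>Instructions 7 to 18 run the \<open>m\<close> stages without printing. Then register 7
  is lowered by \<open>m\<close> to address \<open>n - m + 8\<close>, the last cell to be printed,
  and 21 to 25 print the cells from 8 up to it.\<close>

definition column_prog :: "instr list" where
  "column_prog = [Read 0, Read 7, Const 1 1, Const 6 8, Add 7 7 6, Store 6 1, Const 2 1,
     Jump_less 0 2 19] @ stage 8 @ [Add 2 2 1, Jump 7,
     Const 3 8, Sub 7 7 0, Jump_less 7 3 26, Load 4 3, Print 4, Add 3 3 1, Jump 21, Halt]"

lemma has_stage_column_prog: "has_stage column_prog 8"
  by (simp add: has_stage_def column_prog_def stage_def)

text \<open>As for the row program, but a round ends with only 2 instructions after the stage,
  whence \<open>8 * n + 5\<close>.\<close>

lemma column_prog_loop:
  assumes "m = j + d" and "pc c = 7" and "regs m n (Suc j) c" and "arr n j 0 c" and "out c = []"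
  shows "reaches column_prog (d * (8 * n + 5) + 1) c
    (\<lambda>c'. pc c' = 19 \<and> out c' = [] \<and> regs m n (Suc m) c' \<and> arr n m 0 c')"
  using assms
proof (induction d arbitrary: j c)
  case 0
  have run: "run column_prog 1 c = Some (c\<lparr>pc := 19\<rparr>)"
    using 0(1) by (simp add: step_def column_prog_def stage_def 0(2) regsD[OF 0(3)])
  show ?case
    using 0(1,3-5) by (intro reaches_final[OF run]) (simp_all add: regs_def arr_def)
next
  case (Suc d)
  have m: "m = Suc j + d" using Suc.prems(1) by simp
  have run1: "run column_prog 1 c = Some (c\<lparr>pc := 8\<rparr>)"
    using m by (simp add: step_def column_prog_def stage_def Suc.prems(2) regsD[OF Suc.prems(3)])
  have st: "reaches column_prog (8 * n + 2) (c\<lparr>pc := 8\<rparr>)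
      (\<lambda>c'. pc c' = 17 \<and> out c' = [] \<and> regs m n (Suc j) c' \<and> arr n (Suc j) 0 c')"
    using stage_correct[OF has_stage_column_prog, of "c\<lparr>pc := 8\<rparr>" m n j] Suc.prems(3-5)
    by (simp add: regs_def arr_def)
  have "reaches column_prog (d * (8 * n + 5) + 3) c'
    (\<lambda>c'. pc c' = 19 \<and> out c' = [] \<and> regs m n (Suc m) c' \<and> arr n m 0 c')"
    if c': "pc c' = 17 \<and> out c' = [] \<and> regs m n (Suc j) c' \<and> arr n (Suc j) 0 c'" for c'
  proof -
    have pc: "pc c' = 17" and regs: "regs m n (Suc j) c'" using c' by simp_all
    define c2 where "c2 = c'\<lparr>pc := 7, mem := (mem c')(2 := int (Suc j) + 1)\<rparr>"
    have run: "run column_prog 2 c' = Some c2"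
      by (simp add: run_numeral step_def column_prog_def stage_def set_reg_def pc regsD[OF regs] c2_def
        del: of_nat_Suc)
    have "regs m n (Suc (Suc j)) c2" using regs by (simp add: regs_def c2_def)
    moreover have "arr n (Suc j) 0 c2" using c' by (simp add: arr_def c2_def)
    ultimately have "reaches column_prog (d * (8 * n + 5) + 1) c2
      (\<lambda>c'. pc c' = 19 \<and> out c' = [] \<and> regs m n (Suc m) c' \<and> arr n m 0 c')"
      using c' by (intro Suc.IH[OF m]) (simp_all add: c2_def)
    then show ?thesis by (rule reaches_run[OF run]) simp
  qed
  from reaches_trans[OF st this order_refl]
  show ?case
  proof (rule reaches_run[OF run1])
    show "1 + (8 * n + 2 + (d * (8 * n + 5) + 3)) \<le> Suc d * (8 * n + 5) + 1" by simp
  qed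
qed

text \<open>Cell \<open>i + 8\<close> holds \<open>q m i = P(m + i, m)\<close>, so reading the array
  upwards yields the column in order. Of the \<open>Suc l\<close> entries, \<open>i\<close> are
  printed and \<open>d\<close> remain, at 5 instructions each plus the final test.\<close>

lemma column_prog_print:
  assumes "Suc l = i + d" and "pc c = 21" and "mem c 1 = 1" and "mem c 3 = int i + 8"
    and "mem c 7 = int l + 8" and "arr l m 0 c"
    and "out c = map (\<lambda>k. int (num_partitions k m)) [m..<m + i]"
  shows "reaches column_prog (d * 5 + 1) c
    (\<lambda>c'. halted column_prog c' \<and> out c' = map (\<lambda>k. int (num_partitions k m)) [m..<Suc (m + l)])"
  using assms
proof (induction d arbitrary: i c)
  case 0
  have i: "i = Suc l" using 0(1) by simp
  have run: "run column_prog 1 c = Some (c\<lparr>pc := 26\<rparr>)"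
    by (simp add: step_def column_prog_def stage_def 0(2,4,5) i)
  have "halted column_prog (c\<lparr>pc := 26\<rparr>)"
    by (simp add: halted_def column_prog_def stage_def)
  then show ?case
    using 0(7) i by (intro reaches_final[OF run]) simp_all
next
  case (Suc d)
  have l: "Suc l = Suc i + d" using Suc.prems(1) by simp
  define v where "v = int (num_partitions (m + i) m)"
  have val: "mem c (i + 8) = v"
    using arrD[OF Suc.prems(6), of i] l by (simp add: q_def v_def add.commute)
  have reg: "mem c (Suc 0) = 1" "nat (int i + 8) = i + 8" using Suc.prems(3) by simp_all
  define c2 where "c2 = c\<lparr>pc := 21, out := out c @ [v],
    mem := (mem c)(4 := v, 3 := int (Suc i) + 8)\<rparr>"
  have run: "run column_prog 5 c = Some c2"
    using l by (simp add: run_numeral step_def column_prog_def stage_def set_reg_def Suc.prems(2,4,5)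
      reg val c2_def)
  have "arr l m 0 c2" using Suc.prems(6) by (simp add: arr_def c2_def)
  moreover have "out c2 = map (\<lambda>k. int (num_partitions k m)) [m..<m + Suc i]"
    by (simp add: c2_def v_def Suc.prems(7))
  ultimately have "reaches column_prog (d * 5 + 1) c2
    (\<lambda>c'. halted column_prog c' \<and> out c' = map (\<lambda>k. int (num_partitions k m)) [m..<Suc (m + l)])"
    by (intro Suc.IH[OF l]) (simp_all add: c2_def Suc.prems(5) reg)
  then show ?case by (rule reaches_run[OF run]) simp
qed

lemma column_prog_correct:
  assumes "1 \<le> m" and "m \<le> n"
  shows "computes_within column_prog [int m, int n]
    (map (\<lambda>k. int (num_partitions k m)) [m..<Suc n]) (29 * n\<^sup>2)"
proof -
  define l where "l = n - m"
  have n: "n = m + l" using assms(2) by (simp add: l_def)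
  define c where "c = \<lparr>pc = 7, mem = (\<lambda>_. 0)(0 := int m, 1 := 1, 6 := 8, 7 := int n + 8, 8 := 1, 2 := 1),
    inp = [], out = []\<rparr>"
  have run: "run column_prog 7 (init [int m, int n]) = Some c"
    by (simp add: run_numeral step_def column_prog_def stage_def set_reg_def init_def c_def fun_upd_twist)
  have loop: "reaches column_prog (m * (8 * n + 5) + 1) c
    (\<lambda>c'. pc c' = 19 \<and> out c' = [] \<and> regs m n (Suc m) c' \<and> arr n m 0 c')"
    by (rule column_prog_loop[where j = 0]) (simp_all add: c_def regs_def arr_def q_0)
  have "reaches column_prog (Suc l * 5 + 3) c'
    (\<lambda>c'. halted column_prog c' \<and> out c' = map (\<lambda>k. int (num_partitions k m)) [m..<Suc n])"
    if c': "pc c' = 19 \<and> out c' = [] \<and> regs m n (Suc m) c' \<and> arr n m 0 c'" for c'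
  proof -
    have pc: "pc c' = 19" and regs: "regs m n (Suc m) c'" using c' by simp_all
    have addr: "int n + 8 - int m = int l + 8" using n by simp
    define c2 where "c2 = c'\<lparr>pc := 21, mem := (mem c')(3 := 8, 7 := int l + 8)\<rparr>"
    have run: "run column_prog 2 c' = Some c2"
      by (simp add: run_numeral step_def column_prog_def stage_def set_reg_def pc regsD[OF regs] addr
        c2_def)
    \<comment> \<open>Only the initial segment up to \<open>l = n - m\<close> is printed, so the
      array invariant is restricted to it.\<close>
    have "arr l m 0 c2" using c' n by (simp add: arr_def c2_def)
    then have "reaches column_prog (Suc l * 5 + 1) c2
      (\<lambda>c'. halted column_prog c' \<and> out c' = map (\<lambda>k. int (num_partitions k m)) [m..<Suc (m + l)])"
      using c' by (intro column_prog_print[where i = 0]) (simp_all add: c2_def regsD[OF regs])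
    then show ?thesis unfolding n by (rule reaches_run[OF run]) simp
  qed
  from reaches_trans[OF loop this order_refl]
  show ?thesis unfolding computes_within_iff_reaches
  proof (rule reaches_run[OF run])
    \<comment> \<open>As \<open>m + l = n\<close>, the total is
      \<open>8 * m * n + 5 * n + 16\<close>, and 29 = 8 + 5 + 16.\<close>
    have "n \<le> n\<^sup>2" "1 \<le> n\<^sup>2" "m * n \<le> n\<^sup>2" using assms by (simp_all add: power2_eq_square)
    then show "7 + (m * (8 * n + 5) + 1 + (Suc l * 5 + 3)) \<le> 29 * n\<^sup>2"
      using n by (simp add: algebra_simps)
  qed
qed

theorem mainTheorem5:
  "(\<exists>(prog :: instr list) (C :: nat). \<forall>n :: nat. 1 \<le> n \<longrightarrow>
      computes_within prog [int n] (map (\<lambda>m. int (num_partitions n m)) [1..<Suc n]) (C * n\<^sup>2)) \<and>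
   (\<exists>(prog :: instr list) (C :: nat). \<forall>(m :: nat) (n :: nat). 1 \<le> m \<and> m \<le> n \<longrightarrow>
      computes_within prog [int m, int n] (map (\<lambda>k. int (num_partitions k m)) [m..<Suc n]) (C * n\<^sup>2))"
  using row_prog_correct column_prog_correct by blast

end
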